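(* Let $P=P_1P_2\cdots P_n$ be a discrete conic with angle parameter $\theta$ lying on a conic $c$ with focus $F$. Let $L_i=P_iP_{i+1}$ be its side lines (indices mod $n$), let $k\not\equiv 0 \pmod n$, and let $P'$ be the polygon whose vertices are the intersection points $L_i\cap L_{i+k}$. Then $P'=G_{k\theta}(H_\theta(P))$. In particular, $P'$ is a discrete conic having the same angle parameter $\theta$ and lying on a conic which shares the focus $F$ with $c$.
   Context: Work in the real projective plane containing $\mathbb{R}^2$. Let $C$ be a nondegenerate conic (ellipse, possibly a circle; parabola; or hyperbola) with focus $F$. A discrete conic on $C$ (with respect to $F$, with angle $\theta$) is a closed polygon $V_1V_2\cdots V_n$, $n\ge 3$, with distinct vertices lying on $C$ (indices mod $n$), such that for some fixed $\theta\in\mathbb{R}$ one has $\angle V_iFV_{i+1}=\theta$ (directed angle) for every $i$. Angle convention: when $C$ is a hyperbola or parabola, the rays from $F$ used in measuring angles are allowed to wrap around the plane through infinity. Precisely, choose polar coordinates $(r,\varphi)$ centered at $F$ in which $C$ has equation $r(1+e\cos\varphi)=\ell$ with $\ell>0$, $e\ge 0$, where $r$ may be negative or infinite; each point $V\in C$ then has a unique angle $\varphi(V)$ mod $2\pi$, and $\angle VFW=\theta$ means $\varphi(W)-\varphi(V)\equiv\theta \pmod{2\pi}$. Degenerate case: a line not through $F$ (possibly the line at infinity) is also regarded as a (degenerate) conic with focus $F$; a polygon with vertices $K_i$ on such a line (repetitions allowed) is a discrete conic with angle $\theta$ if the directed angle from line $FK_i$ to line $FK_{i+1}$ is $\theta$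 mod $\pi$ for all $i$. For $P'$ above this degenerate case occurs exactly when $k\theta\equiv\pi \pmod{2\pi}$. Operations on discrete conics. If $D=V_1\cdots V_n$ is a discrete conic with angle $\theta$ on $C$, then $G_{k\theta}(D)$ is the polygon whose vertices are the intersections of the tangents to $C$ at $V_i$ and $V_{i+k}$ (which satisfy $\angle V_iFV_{i+k}=k\theta$). The lines $V_iV_{i+1}$ are all tangent to a conic with focus $F$, and $H_\theta(D)$ is the polygon formed by the points of tangency of the lines $V_iV_{i+1}$ with that conic, viewed as a discrete conic lying on that conic (so that $G_\theta(H_\theta(D))=D$). *)

theory Defs
  imports "HOL-Analysis.Analysis" "HOL-Library.Real_Mod" "HOL-Number_Theory.Cong"
begin

text \<open>
  Homogeneous coordinates are pairs \<open>(x, z)\<close> with \<open>x :: real^2\<close>: for \<open>z \<noteq> 0\<close> they denote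
  the affine point \<open>x / z\<close>, for \<open>z = 0\<close> the point at infinity in direction \<open>x\<close>.
  Points of the projective plane are the one-dimensional subspaces.
\<close>

typedef rp2 = "{S :: ((real^2) \<times> real) set. \<exists>v. v \<noteq> 0 \<and> S = span {v}}"
proof -
  have "((0, 1) :: (real^2) \<times> real) \<noteq> 0" by (simp add: zero_prod_def)
  then show ?thesis by blast
qed

text \<open>The value \<open>proj 0\<close> is junk.\<close>

definition proj :: "(real^2) \<times> real \<Rightarrow> rp2" where
  "proj v = Abs_rp2 (span {v})"

definition affine_pt :: "real^2 \<Rightarrow> rp2" where
  "affine_pt x = proj (x, 1)"

definition is_line :: "rp2 set \<Rightarrow> bool" where
  "is_line L \<longleftrightarrow> (\<exists>a. a \<noteq> 0 \<and> L = {p. \<forall>v \<in> Rep_rp2 p. a \<bullet> v = 0})"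

definition join :: "rp2 \<Rightarrow> rp2 \<Rightarrow> rp2 set" where
  "join p q = (THE L. is_line L \<and> p \<in> L \<and> q \<in> L)"

definition meet :: "rp2 set \<Rightarrow> rp2 set \<Rightarrow> rp2" where
  "meet L M = (THE p. p \<in> L \<and> p \<in> M)"

definition unit_dir :: "real \<Rightarrow> real^2" where
  "unit_dir \<alpha> = vector [cos \<alpha>, sin \<alpha>]"

text \<open>
  The point with polar coordinates \<open>(r, \<phi>)\<close>, centre \<open>F\<close> and polar axis in direction \<open>\<omega>\<close>, on the
  curve \<open>r (1 + e cos \<phi>) = l\<close>. Multiplying \<open>(F + r unit_dir (\<omega> + \<phi>), 1)\<close> by \<open>1 + e cos \<phi>\<close> also
  covers \<open>r = \<infinity>\<close>, that is \<open>1 + e cos \<phi> = 0\<close>; \<open>r\<close> is negative if \<open>1 + e cos \<phi> < 0\<close>.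
\<close>

definition polar_pt :: "real^2 \<Rightarrow> real \<Rightarrow> real \<Rightarrow> real \<Rightarrow> real \<Rightarrow> rp2" where
  "polar_pt F \<omega> e l \<phi> =
     proj ((1 + e * cos \<phi>) *\<^sub>R F + l *\<^sub>R unit_dir (\<omega> + \<phi>), 1 + e * cos \<phi>)"

definition polar_eqn :: "real^2 \<Rightarrow> rp2 set \<Rightarrow> real \<Rightarrow> real \<Rightarrow> real \<Rightarrow> bool" where
  "polar_eqn F C \<omega> e l \<longleftrightarrow> e \<ge> 0 \<and> l > 0 \<and> C = range (polar_pt F \<omega> e l)"

definition conic_with_focus :: "real^2 \<Rightarrow> rp2 set \<Rightarrow> bool" where
  "conic_with_focus F C \<longleftrightarrow> (\<exists>\<omega> e l. polar_eqn F C \<omega> e l)"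

text \<open>
  The set \<open>C\<close> determines \<open>e\<close> and \<open>l\<close>, and also \<open>\<omega>\<close> modulo \<open>2\<pi>\<close> unless \<open>e = 0\<close>; hence the
  directed angle does not depend on the choice of polar coordinates.
\<close>

definition directed_angle :: "real^2 \<Rightarrow> rp2 set \<Rightarrow> rp2 \<Rightarrow> rp2 \<Rightarrow> real \<Rightarrow> bool" where
  "directed_angle F C V W \<theta> \<longleftrightarrow>
     (\<exists>\<omega> e l \<phi> \<psi>. polar_eqn F C \<omega> e l \<and> V = polar_pt F \<omega> e l \<phi> \<and> W = polar_pt F \<omega> e l \<psi> \<and>
        [\<psi> - \<phi> = \<theta>] (rmod (2 * pi)))"

text \<open>A closed \<open>n\<close>-gon is an \<open>n\<close>-periodic family of vertices indexed by the integers.\<close>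

definition closed_polygon :: "nat \<Rightarrow> (int \<Rightarrow> rp2) \<Rightarrow> bool" where
  "closed_polygon n V \<longleftrightarrow> n \<ge> 3 \<and> (\<forall>i. V (i + int n) = V i)"

definition discrete_conic :: "real^2 \<Rightarrow> rp2 set \<Rightarrow> real \<Rightarrow> nat \<Rightarrow> (int \<Rightarrow> rp2) \<Rightarrow> bool" where
  "discrete_conic F C \<theta> n V \<longleftrightarrow>
     conic_with_focus F C \<and> closed_polygon n V \<and> inj_on V {0..<int n} \<and> (\<forall>i. V i \<in> C) \<and>
     (\<forall>i. directed_angle F C (V i) (V (i + 1)) \<theta>)"

definition dir_line :: "real^2 \<Rightarrow> real \<Rightarrow> rp2 set" where
  "dir_line F \<alpha> = join (affine_pt F) (proj (unit_dir \<alpha>, 0))"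

definition degenerate_discrete_conic ::
  "real^2 \<Rightarrow> rp2 set \<Rightarrow> real \<Rightarrow> nat \<Rightarrow> (int \<Rightarrow> rp2) \<Rightarrow> bool" where
  "degenerate_discrete_conic F M \<theta> n K \<longleftrightarrow>
     is_line M \<and> affine_pt F \<notin> M \<and> closed_polygon n K \<and> (\<forall>i. K i \<in> M) \<and>
     (\<forall>i. \<exists>\<alpha> \<beta>. join (affine_pt F) (K i) = dir_line F \<alpha> \<and>
        join (affine_pt F) (K (i + 1)) = dir_line F \<beta> \<and> [\<beta> - \<alpha> = \<theta>] (rmod pi))"

text \<open>
  \<open>L\<close> is the tangent at \<open>V\<close> of a regular curve running inside \<open>C\<close>. The curve is given by a lift
  \<open>\<gamma>\<close> to homogeneous coordinates; it is regular at \<open>t\<close> iff \<open>\<gamma> t\<close> and \<open>\<gamma>'\<close> are linearly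
  independent, and then its tangent line is the one they span.
\<close>

definition tangent_at :: "rp2 set \<Rightarrow> rp2 \<Rightarrow> rp2 set \<Rightarrow> bool" where
  "tangent_at C V L \<longleftrightarrow>
     (\<exists>\<gamma> \<gamma>' t. (\<forall>s. \<gamma> s \<noteq> 0 \<and> proj (\<gamma> s) \<in> C) \<and> (\<gamma> has_vector_derivative \<gamma>') (at t) \<and>
        \<gamma>' \<notin> span {\<gamma> t} \<and> V = proj (\<gamma> t) \<and> L = join (proj (\<gamma> t)) (proj \<gamma>'))"

definition tangent :: "rp2 set \<Rightarrow> rp2 \<Rightarrow> rp2 set" where
  "tangent C V = (THE L. tangent_at C V L)"

definition side :: "(int \<Rightarrow> rp2) \<Rightarrow> int \<Rightarrow> rp2 set" where
  "side V i = join (V i) (V (i + 1))"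

text \<open>
  The operations take (or yield) a polygon together with the conic carrying it, since three
  vertices do not determine it, even if the focus is given. \<open>G_op k\<close> is \<open>G\<^bsub>k\<theta>\<^esub>\<close> for polygons with angle \<open>\<theta>\<close>.
\<close>

definition G_op :: "int \<Rightarrow> rp2 set \<times> (int \<Rightarrow> rp2) \<Rightarrow> int \<Rightarrow> rp2" where
  "G_op k = (\<lambda>(C, V) i. meet (tangent C (V i)) (tangent C (V (i + k))))"

text \<open>
  Tangents of conics with focus \<open>F\<close> do not pass through \<open>F\<close>, and three of them determine the
  conic: their polar duals with respect to a circle around \<open>F\<close> lie on a circle.
\<close>

definition H_conic :: "real^2 \<Rightarrow> (int \<Rightarrow> rp2) \<Rightarrow> rp2 set" where
  "H_conic F V = (THE C. conic_with_focus F C \<and> (\<forall>i. \<exists>T. tangent_at C T (side V i)))"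

definition H_op :: "real^2 \<Rightarrow> (int \<Rightarrow> rp2) \<Rightarrow> rp2 set \<times> (int \<Rightarrow> rp2)" where
  "H_op F V = (H_conic F V, \<lambda>i. THE T. tangent_at (H_conic F V) T (side V i))"

end

theory Submission
  imports Defs
begin

text \<open>
  Take \<open>F\<close> as origin and let \<open>u \<alpha>\<close> be the unit vector with angle \<open>\<alpha>\<close>. A conic with focus \<open>F\<close> consists
  of the points with homogeneous coordinates \<open>(u \<alpha>, a + b \<bullet> u \<alpha>)\<close>, where \<open>a \<noteq> 0\<close>; replacing \<open>a\<close> by
  \<open>- a\<close> shifts \<open>\<alpha>\<close> by \<open>\<pi>\<close>. The points with angles \<open>\<beta> \<plusminus> \<delta>\<close> are joined by the line
  \<open>z = (b + (a / cos \<delta>) u \<beta>) \<bullet> x\<close>, which for \<open>\<delta> = 0\<close> is the tangent at angle \<open>\<beta>\<close>. Hence chords of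
  \<open>(a, b)\<close> with half angle \<open>\<delta>\<close> are the tangents of \<open>(a / cos \<delta>, b)\<close>, and the tangents of \<open>(a, b)\<close> at
  \<open>\<beta> \<plusminus> \<delta>\<close> meet in the point of \<open>(a cos \<delta>, b)\<close> with angle \<open>\<beta>\<close>, a curve that degenerates to a line
  iff \<open>cos \<delta> = 0\<close>. The conic touching the sides is unique because the vectors \<open>b + a u \<beta>\<close> of its
  tangents lie on the circle with centre \<open>b\<close> and radius \<open>\<bar>a\<bar>\<close>, which three points determine.
\<close>

section \<open>Lines of the projective plane\<close>

definition zero_line :: "(real^2) \<times> real \<Rightarrow> rp2 set" where
  "zero_line a = {p. \<forall>v \<in> Rep_rp2 p. a \<bullet> v = 0}"

lemma is_line_iff: "is_line L \<longleftrightarrow> (\<exists>a. a \<noteq> 0 \<and> L = zero_line a)"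
  by (simp add: is_line_def zero_line_def)

lemma Rep_rp2_proj: "v \<noteq> 0 \<Longrightarrow> Rep_rp2 (proj v) = span {v}"
  unfolding proj_def by (rule Abs_rp2_inverse) blast

lemma rp2_cases: obtains v where "v \<noteq> 0" "p = proj v"
proof -
  obtain v where "v \<noteq> 0" "Rep_rp2 p = span {v}" using Rep_rp2[of p] by auto
  then have "p = proj v" unfolding proj_def by (metis Rep_rp2_inverse)
  with \<open>v \<noteq> 0\<close> show thesis using that by blast
qed

lemma proj_scale: "c \<noteq> 0 \<Longrightarrow> proj (c *\<^sub>R v) = proj v"
proof -
  assume "c \<noteq> 0"
  then have "span {c *\<^sub>R v} = span {v}"
    by (metis span_image_scale[of "{v}" "\<lambda>_. c"] finite.emptyI finite_insert image_empty image_insert singletonD)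
  then show ?thesis by (simp add: proj_def)
qed

lemma proj_eqD:
  assumes "v \<noteq> 0" "w \<noteq> 0" "proj v = proj w"
  obtains c where "c \<noteq> 0" "v = c *\<^sub>R w"
proof -
  have "v \<in> span {w}"
    using assms by (metis Rep_rp2_proj span_base singletonI)
  then obtain c where "v = c *\<^sub>R w" by (auto simp: span_singleton)
  with assms(1) show thesis using that by auto
qed

lemma proj_mem_zero_line: "v \<noteq> 0 \<Longrightarrow> proj v \<in> zero_line a \<longleftrightarrow> a \<bullet> v = 0"
  by (auto simp: zero_line_def Rep_rp2_proj span_singleton)

lemma proj_neq_independent:
  assumes "v \<noteq> 0" "w \<noteq> 0" "proj v \<noteq> proj w"
  shows "independent {v, w}" "v \<noteq> w"
proof -
  show "v \<noteq> w" using assms by auto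
  have "v \<notin> span {w}"
    using assms proj_scale[of _ w] by (auto simp del: scaleR_Pair simp: span_singleton)
  then show "independent {v, w}"
    using assms by (simp add: independent_insert)
qed

text \<open>The plane orthogonal to \<open>a\<close> has dimension 2, so \<open>v\<close> and
  \<open>w\<close> span it. The description no longer mentions \<open>a\<close>, hence lines through
  the same two points coincide.\<close>

lemma zero_line_through_points:
  assumes v: "v \<noteq> 0" and w: "w \<noteq> 0" and neq: "proj v \<noteq> proj w"
    and a: "a \<noteq> 0" "a \<bullet> v = 0" "a \<bullet> w = 0"
  shows "zero_line a = {p. Rep_rp2 p \<subseteq> span {v, w}}"
proof -
  note ind = proj_neq_independent[OF v w neq]
  have dim: "dim {x. a \<bullet> x = 0} = 2"
    using dim_hyperplane[OF a(1)] by simp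
  have "dim {v, w} = 2"
    using ind by (simp add: dim_eq_card_independent)
  then have "span {v, w} = span {x. a \<bullet> x = 0}"
    using dim a by (intro dim_eq_span) auto
  also have "\<dots> = {x. a \<bullet> x = 0}"
    by (rule span_eq_iff[THEN iffD2]) (rule subspace_hyperplane)
  finally show ?thesis by (auto simp: zero_line_def)
qed

lemma line_through_unique:
  assumes "p \<noteq> q" "is_line L" "p \<in> L" "q \<in> L" "is_line M" "p \<in> M" "q \<in> M"
  shows "L = M"
proof -
  obtain v w where vw: "v \<noteq> 0" "p = proj v" "w \<noteq> 0" "q = proj w"
    using rp2_cases by metis
  obtain a b where "a \<noteq> 0" "L = zero_line a" "b \<noteq> 0" "M = zero_line b"
    using assms by (auto simp: is_line_iff)
  with vw assms show ?thesis
    by (metis proj_mem_zero_line zero_line_through_points)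
qed

lemma join_eqI:
  assumes "p \<noteq> q" "is_line L" "p \<in> L" "q \<in> L"
  shows "join p q = L"
  unfolding join_def using assms line_through_unique by (intro the_equality) blast+

lemma meet_eqI:
  assumes "L \<noteq> M" "is_line L" "is_line M" "p \<in> L" "p \<in> M"
  shows "meet L M = p"
  unfolding meet_def using assms line_through_unique by (intro the_equality) blast+

section \<open>Unit vectors\<close>

lemma unit_dir_nth [simp]: "unit_dir \<alpha> $ 1 = cos \<alpha>" "unit_dir \<alpha> $ 2 = sin \<alpha>"
  by (simp_all add: unit_dir_def)

lemma inner_unit_dir: "d \<bullet> unit_dir \<alpha> = d $ 1 * cos \<alpha> + d $ 2 * sin \<alpha>"
  by (simp add: inner_vec_def sum_2)

lemma unit_dir_inner: "unit_dir \<alpha> \<bullet> unit_dir \<beta> = cos (\<alpha> - \<beta>)"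
  by (simp add: inner_unit_dir cos_diff)

lemma norm_unit_dir [simp]: "norm (unit_dir \<alpha>) = 1"
  by (simp add: norm_eq_sqrt_inner unit_dir_inner)

lemma unit_dir_nonzero [simp]: "unit_dir \<alpha> \<noteq> 0"
  using norm_unit_dir[of \<alpha>] by (metis norm_zero zero_neq_one)

lemma unit_dir_add_pi: "unit_dir (\<alpha> + pi) = - unit_dir \<alpha>"
  by (simp add: vec_eq_iff forall_2)

lemma unit_dir_add: "unit_dir (\<alpha> + \<beta>) = cos \<beta> *\<^sub>R unit_dir \<alpha> + sin \<beta> *\<^sub>R unit_dir (\<alpha> + pi / 2)"
  by (simp add: vec_eq_iff forall_2 cos_add sin_add)

lemma unit_dir_eq_iff: "unit_dir \<alpha> = unit_dir \<beta> \<longleftrightarrow> [\<alpha> = \<beta>] (rmod (2 * pi))"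
proof -
  have "unit_dir \<alpha> = unit_dir \<beta> \<longleftrightarrow> sin \<beta> = sin \<alpha> \<and> cos \<beta> = cos \<alpha>"
    by (auto simp: vec_eq_iff forall_2)
  also have "\<dots> \<longleftrightarrow> [\<alpha> = \<beta>] (rmod (2 * pi))"
    by (auto simp: sin_cos_eq_iff rcong_altdef algebra_simps)
  finally show ?thesis .
qed

lemma real2_eq_norm_unit_dir: obtains \<omega> where "b = norm b *\<^sub>R unit_dir \<omega>"
proof (cases "b = 0")
  case False
  let ?x = "b $ 1 / norm b" and ?y = "b $ 2 / norm b"
  have "(norm b)\<^sup>2 = (b $ 1)\<^sup>2 + (b $ 2)\<^sup>2"
    unfolding power2_norm_eq_inner by (simp add: inner_vec_def sum_2 power2_eq_square)
  then have "?x\<^sup>2 + ?y\<^sup>2 = 1"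
    using False
    by (metis add_divide_distrib divide_self norm_eq_zero power_divide power_eq_0_iff)
  then obtain t where t: "?x = cos t" "?y = sin t"
    using sincos_total_2pi by metis
  have "b = norm b *\<^sub>R unit_dir t"
    using False by (simp add: vec_eq_iff forall_2 flip: t)
  then show thesis using that by blast
qed (use that in auto)

text \<open>For \<open>sin \<theta> \<noteq> 0\<close> the three directions are distinct points of
  the unit circle, hence not collinear, while a nonzero \<open>d\<close> would put them on the line
  \<open>d \<bullet> x = s\<close>.\<close>

lemma inner_unit_dir_constant:
  assumes "sin \<theta> \<noteq> 0" and "d \<bullet> unit_dir (\<alpha> - \<theta>) = s" "d \<bullet> unit_dir \<alpha> = s"
    "d \<bullet> unit_dir (\<alpha> + \<theta>) = s"
  shows "d = 0" "s = 0"
proof -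
  let ?u = "unit_dir \<alpha>" and ?v = "unit_dir (\<alpha> + pi / 2)"
  have "cos \<theta> * s + sin \<theta> * (d \<bullet> ?v) = s" "cos \<theta> * s - sin \<theta> * (d \<bullet> ?v) = s"
    using assms unit_dir_add[of \<alpha> \<theta>] unit_dir_add[of \<alpha> "- \<theta>"] by (auto simp: inner_simps)
  then have 1: "sin \<theta> * (d \<bullet> ?v) = 0" and "cos \<theta> * s = s" by linarith+
  moreover have "cos \<theta> \<noteq> 1" using assms(1) cos_one_sin_zero by blast
  ultimately show s: "s = 0" by simp
  have v: "d \<bullet> ?v = 0" using 1 assms by simp
  have "d = (d \<bullet> ?u) *\<^sub>R ?u + (d \<bullet> ?v) *\<^sub>R ?v"
  proof -
    have "x = cos \<alpha> * (cos \<alpha> * x) + sin \<alpha> * (sin \<alpha> * x)" for x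
      using sin_cos_squared_add3[of \<alpha>] by (metis distrib_right mult.assoc mult_1)
    from this[of "d $ 1"] this[of "d $ 2"] show ?thesis
      by (simp add: vec_eq_iff forall_2 inner_unit_dir cos_add sin_add algebra_simps)
  qed
  then show "d = 0" using s v assms by simp
qed


lemma inner_unit_dir_all_zero: "(\<And>\<alpha>. d \<bullet> unit_dir \<alpha> = 0) \<Longrightarrow> d = 0"
  by (metis inner_commute inner_eq_zero_iff inner_scaleR_right mult_zero_right real2_eq_norm_unit_dir)

section \<open>Coordinates centred at the focus\<close>

text \<open>Translation by \<open>F\<close> in homogeneous coordinates; points at infinity, with
  \<open>z = 0\<close>, stay fixed.\<close>

definition homog :: "real^2 \<Rightarrow> real^2 \<Rightarrow> real \<Rightarrow> (real^2) \<times> real" where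
  "homog F x z = (x + z *\<^sub>R F, z)"

lemma homog_scale: "c *\<^sub>R homog F x z = homog F (c *\<^sub>R x) (c * z)"
  by (simp add: homog_def scaleR_add_right)

lemma homog_eq_iff [simp]: "homog F x z = homog F x' z' \<longleftrightarrow> x = x' \<and> z = z'"
  by (auto simp: homog_def)

lemma homog_eq_0_iff [simp]: "homog F x z = 0 \<longleftrightarrow> x = 0 \<and> z = 0"
  by (auto simp: homog_def zero_prod_def)

lemma homog_eq: "v = homog F (fst v - snd v *\<^sub>R F) (snd v)"
  by (simp add: homog_def)

text \<open>The line \<open>z = m \<bullet> x\<close> in coordinates centred at \<open>F\<close>; it is the line at infinity if \<open>m = 0\<close>.\<close>

definition affine_line :: "real^2 \<Rightarrow> real^2 \<Rightarrow> rp2 set" where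
  "affine_line F m = zero_line (m, - (1 + m \<bullet> F))"

lemma is_line_affine_line: "is_line (affine_line F m)"
  unfolding is_line_iff affine_line_def
  by (rule exI[of _ "(m, - (1 + m \<bullet> F))"]) (auto simp: zero_prod_def)

lemma proj_homog_mem_affine_line:
  "x \<noteq> 0 \<or> z \<noteq> 0 \<Longrightarrow> proj (homog F x z) \<in> affine_line F m \<longleftrightarrow> z = m \<bullet> x"
proof -
  assume "x \<noteq> 0 \<or> z \<noteq> 0"
  then have "proj (homog F x z) \<in> affine_line F m \<longleftrightarrow> (m, - (1 + m \<bullet> F)) \<bullet> homog F x z = 0"
    unfolding affine_line_def by (intro proj_mem_zero_line) auto
  then show ?thesis by (auto simp: homog_def inner_simps algebra_simps)
qed

lemma affine_pt_eq_proj_homog: "affine_pt F = proj (homog F 0 1)"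
  by (simp add: affine_pt_def homog_def)

lemma focus_notin_affine_line: "affine_pt F \<notin> affine_line F m"
  by (simp add: affine_pt_eq_proj_homog proj_homog_mem_affine_line)

text \<open>The point in direction \<open>\<alpha>\<close> reveals
  \<open>m \<bullet> unit_dir \<alpha>\<close>. Thus \<open>m\<close> is a faithful dual coordinate,
  the pole of the line with respect to the unit circle around \<open>F\<close>.\<close>

lemma affine_line_inject [simp]: "affine_line F m = affine_line F m' \<longleftrightarrow> m = m'"
proof
  assume eq: "affine_line F m = affine_line F m'"
  have "m \<bullet> unit_dir \<alpha> = m' \<bullet> unit_dir \<alpha>" for \<alpha>
    using eq proj_homog_mem_affine_line[of "unit_dir \<alpha>" "m \<bullet> unit_dir \<alpha>" F] by auto
  then have "m - m' = 0" by (intro inner_unit_dir_all_zero) (simp add: inner_simps)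
  then show "m = m'" by simp
qed auto

lemma line_not_through_focus:
  assumes "is_line M" "affine_pt F \<notin> M"
  obtains m where "M = affine_line F m"
proof -
  obtain p q where M: "M = zero_line (p, q)"
    using assms(1) by (auto simp: is_line_iff)
  \<comment> \<open>The value at \<open>F\<close> of the form defining \<open>M\<close>: in centred
    coordinates \<open>M\<close> reads \<open>p \<bullet> x + r * z = 0\<close>, to be solved for
    \<open>z\<close>.\<close>
  define r where "r = p \<bullet> F + q"
  have "r \<noteq> 0"
    using assms(2) unfolding affine_pt_eq_proj_homog M
    by (simp add: proj_mem_zero_line) (simp add: homog_def r_def)
  define m where "m = (- 1 / r) *\<^sub>R p"
  have "proj v \<in> M \<longleftrightarrow> proj v \<in> affine_line F m" if "v \<noteq> 0" for v
  proof -
    obtain x z where v: "v = homog F x z" using homog_eq by blast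
    have "proj v \<in> M \<longleftrightarrow> p \<bullet> x + r * z = 0"
      using that unfolding M by (simp add: proj_mem_zero_line v) (simp add: homog_def r_def inner_simps algebra_simps)
    also have "\<dots> \<longleftrightarrow> z = m \<bullet> x"
      using \<open>r \<noteq> 0\<close> by (auto simp: m_def field_simps)
    also have "\<dots> \<longleftrightarrow> proj v \<in> affine_line F m"
      using that by (auto simp: v proj_homog_mem_affine_line)
    finally show ?thesis .
  qed
  then have "M = affine_line F m" by (metis rp2_cases set_eqI)
  then show thesis using that by blast
qed

section \<open>Conics with a given focus\<close>

text \<open>The value \<open>a = 0\<close> is admitted: it parametrises the line \<open>z = b \<bullet> x\<close>.\<close>

definition conic_pt :: "real^2 \<Rightarrow> real \<Rightarrow> real^2 \<Rightarrow> real \<Rightarrow> rp2" where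
  "conic_pt F a b \<alpha> = proj (homog F (unit_dir \<alpha>) (a + b \<bullet> unit_dir \<alpha>))"

lemma conic_pt_mem_affine_line:
  "conic_pt F a b \<alpha> \<in> affine_line F m \<longleftrightarrow> a + b \<bullet> unit_dir \<alpha> = m \<bullet> unit_dir \<alpha>"
  by (simp add: conic_pt_def proj_homog_mem_affine_line)

lemma conic_pt_cong: "[\<alpha> = \<beta>] (rmod (2 * pi)) \<Longrightarrow> conic_pt F a b \<alpha> = conic_pt F a b \<beta>"
  by (simp add: conic_pt_def flip: unit_dir_eq_iff)

text \<open>Both vector parts have norm 1, so the factor between the representatives is 1 or
  -1.\<close>

lemma conic_pt_eqD:
  assumes "conic_pt F a b \<alpha> = conic_pt F a' b' \<beta>"
  obtains "unit_dir \<alpha> = unit_dir \<beta>" "a + b \<bullet> unit_dir \<alpha> = a' + b' \<bullet> unit_dir \<alpha>"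
  | "unit_dir \<alpha> = - unit_dir \<beta>" "a + b \<bullet> unit_dir \<alpha> = - a' + b' \<bullet> unit_dir \<alpha>"
proof -
  obtain c where c: "homog F (unit_dir \<alpha>) (a + b \<bullet> unit_dir \<alpha>) = c *\<^sub>R homog F (unit_dir \<beta>) (a' + b' \<bullet> unit_dir \<beta>)"
    using assms unfolding conic_pt_def by (metis homog_eq_0_iff proj_eqD unit_dir_nonzero)
  then have u: "unit_dir \<alpha> = c *\<^sub>R unit_dir \<beta>"
    and s: "a + b \<bullet> unit_dir \<alpha> = c * (a' + b' \<bullet> unit_dir \<beta>)"
    by (metis homog_scale homog_eq_iff)+
  have "\<bar>c\<bar> = 1" using arg_cong[OF u, of norm] by simp
  then have "c = 1 \<or> c = - 1" by linarith
  then show thesis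
    using that u s by auto
qed

text \<open>Opposite directions would give \<open>a = - a\<close>. For \<open>a = 0\<close> they do
  give equal points: the line is then covered twice.\<close>

lemma conic_pt_eq_iff:
  "a \<noteq> 0 \<Longrightarrow> conic_pt F a b \<alpha> = conic_pt F a b \<beta> \<longleftrightarrow> [\<alpha> = \<beta>] (rmod (2 * pi))"
  by (auto simp: unit_dir_eq_iff intro: conic_pt_cong elim!: conic_pt_eqD)

lemma conic_pt_uminus: "conic_pt F (- a) b \<alpha> = conic_pt F a b (\<alpha> + pi)"
proof -
  have "homog F (unit_dir (\<alpha> + pi)) (a + b \<bullet> unit_dir (\<alpha> + pi)) =
      (- 1) *\<^sub>R homog F (unit_dir \<alpha>) (- a + b \<bullet> unit_dir \<alpha>)"
    unfolding homog_scale by (simp add: unit_dir_add_pi)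
  then show ?thesis unfolding conic_pt_def by (metis neg_equal_0_iff_equal proj_scale zero_neq_one)
qed

lemma range_conic_pt_uminus: "range (conic_pt F (- a) b) = range (conic_pt F a b)"
proof -
  have "range (conic_pt F (- a) b) \<subseteq> range (conic_pt F a b)" for a
    by (auto simp: conic_pt_uminus)
  from this[of a] this[of "- a"] show ?thesis by auto
qed

text \<open>This makes angles independent of the polar coordinates chosen: only the sign of
  \<open>a\<close> is lost, and changing it shifts all angles by \<open>pi\<close>.\<close>

lemma range_conic_pt_subsetD:
  assumes "a \<noteq> 0" "range (conic_pt F a b) \<subseteq> range (conic_pt F a' b')"
  shows "b = b'" "\<bar>a\<bar> = \<bar>a'\<bar>"
proof -
  have *: "\<bar>a + (b - b') \<bullet> unit_dir \<alpha>\<bar> = \<bar>a'\<bar>" for \<alpha>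
  proof -
    obtain \<beta> where "conic_pt F a b \<alpha> = conic_pt F a' b' \<beta>" using assms(2) by blast
    then show ?thesis by (rule conic_pt_eqD) (auto simp: inner_simps)
  qed
  have "b - b' = 0"
  proof (rule inner_unit_dir_all_zero)
    fix \<alpha>
    \<comment> \<open>With \<open>t\<close> for this inner product, opposite directions give
      \<open>\<bar>a + t\<bar> = \<bar>a - t\<bar>\<close>, which forces \<open>t = 0\<close> as
      \<open>a \<noteq> 0\<close>.\<close>
    show "(b - b') \<bullet> unit_dir \<alpha> = 0"
      using *[of \<alpha>] *[of "\<alpha> + pi"] \<open>a \<noteq> 0\<close> by (auto simp: unit_dir_add_pi)
  qed
  then show "b = b'" by simp
  then show "\<bar>a\<bar> = \<bar>a'\<bar>" using * by simp
qed

section \<open>The parametrisation and polar coordinates\<close>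

lemma polar_pt_eq_conic_pt:
  assumes "l > 0"
  shows "polar_pt F \<omega> e l \<phi> = conic_pt F (1 / l) ((e / l) *\<^sub>R unit_dir \<omega>) (\<omega> + \<phi>)"
proof -
  \<comment> \<open>Dividing by \<open>l\<close> leaves the constant term \<open>1 / l\<close> and
    turns the eccentricity into a vector of length \<open>e / l\<close> along the polar
    axis.\<close>
  have "((1 + e * cos \<phi>) *\<^sub>R F + l *\<^sub>R unit_dir (\<omega> + \<phi>), 1 + e * cos \<phi>) =
    l *\<^sub>R homog F (unit_dir (\<omega> + \<phi>)) (1 / l + ((e / l) *\<^sub>R unit_dir \<omega>) \<bullet> unit_dir (\<omega> + \<phi>))"
  proof -
    have "l * (1 / l + ((e / l) *\<^sub>R unit_dir \<omega>) \<bullet> unit_dir (\<omega> + \<phi>)) = 1 + e * cos \<phi>"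
      using assms by (simp add: unit_dir_inner field_simps)
    then show ?thesis unfolding homog_scale by (simp add: homog_def add.commute)
  qed
  then show ?thesis
    unfolding polar_pt_def conic_pt_def using assms by (metis less_irrefl proj_scale)
qed

lemma polar_eqn_iff:
  "polar_eqn F C \<omega> e l \<longleftrightarrow>
     e \<ge> 0 \<and> l > 0 \<and> C = range (conic_pt F (1 / l) ((e / l) *\<^sub>R unit_dir \<omega>))"
proof -
  have "range (polar_pt F \<omega> e l) = range (conic_pt F (1 / l) ((e / l) *\<^sub>R unit_dir \<omega>))" if "l > 0"
  proof -
    have "polar_pt F \<omega> e l = conic_pt F (1 / l) ((e / l) *\<^sub>R unit_dir \<omega>) \<circ> (+) \<omega>"
      using that by (auto simp: polar_pt_eq_conic_pt)
    then show ?thesis by (metis fun.set_map surj_plus)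
  qed
  then show ?thesis by (auto simp: polar_eqn_def)
qed

lemma conic_with_focus_iff:
  "conic_with_focus F C \<longleftrightarrow> (\<exists>a b. a \<noteq> 0 \<and> C = range (conic_pt F a b))"
proof
  assume "conic_with_focus F C"
  then obtain \<omega> e l where "l > 0" "C = range (conic_pt F (1 / l) ((e / l) *\<^sub>R unit_dir \<omega>))"
    by (auto simp: conic_with_focus_def polar_eqn_iff)
  then show "\<exists>a b. a \<noteq> 0 \<and> C = range (conic_pt F a b)"
    by (metis less_irrefl zero_less_divide_1_iff)
next
  assume "\<exists>a b. a \<noteq> 0 \<and> C = range (conic_pt F a b)"
  then obtain a b where "a \<noteq> 0" "C = range (conic_pt F a b)" by blast
  then have C: "C = range (conic_pt F \<bar>a\<bar> b)"
    by (auto simp: abs_if range_conic_pt_uminus)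
  obtain \<omega> where "b = norm b *\<^sub>R unit_dir \<omega>" by (rule real2_eq_norm_unit_dir)
  then have "polar_eqn F C \<omega> (norm b / \<bar>a\<bar>) (1 / \<bar>a\<bar>)"
    using C \<open>a \<noteq> 0\<close> by (simp add: polar_eqn_iff)
  then show "conic_with_focus F C" by (auto simp: conic_with_focus_def)
qed

text \<open>The offset is \<open>\<omega>\<close> for \<open>a > 0\<close> and
  \<open>\<omega> + pi\<close> for \<open>a < 0\<close>; being constant, it cancels in differences
  of angles.\<close>

lemma polar_pt_on_conic:
  assumes "a \<noteq> 0" "polar_eqn F (range (conic_pt F a b)) \<omega> e l"
  obtains s where "\<And>\<phi>. polar_pt F \<omega> e l \<phi> = conic_pt F a b (\<phi> + s)"
proof -
  have l: "l > 0" and "range (conic_pt F a b) = range (conic_pt F (1 / l) ((e / l) *\<^sub>R unit_dir \<omega>))"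
    using assms(2) by (auto simp: polar_eqn_iff)
  then have b: "b = (e / l) *\<^sub>R unit_dir \<omega>" and a: "\<bar>a\<bar> = \<bar>1 / l\<bar>"
    using range_conic_pt_subsetD[OF assms(1), of F b] by blast+
  show thesis
  proof (cases "1 / l = a")
    case True
    then show thesis
      using that[of \<omega>] l b by (metis add.commute polar_pt_eq_conic_pt)
  next
    case False
    then have "1 / l = - a" using a by linarith
    then show thesis
      using that[of "\<omega> + pi"] l b
      by (metis add.commute add.left_commute conic_pt_uminus polar_pt_eq_conic_pt)
  qed
qed

lemma directed_angle_conic_pt_iff:
  assumes "a \<noteq> 0"
  shows "directed_angle F (range (conic_pt F a b)) (conic_pt F a b \<alpha>) W \<theta> \<longleftrightarrow>
    W = conic_pt F a b (\<alpha> + \<theta>)"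
proof
  assume "directed_angle F (range (conic_pt F a b)) (conic_pt F a b \<alpha>) W \<theta>"
  then obtain \<omega> e l \<phi> \<psi> where "polar_eqn F (range (conic_pt F a b)) \<omega> e l"
    and V: "conic_pt F a b \<alpha> = polar_pt F \<omega> e l \<phi>" and W: "W = polar_pt F \<omega> e l \<psi>"
    and \<theta>: "[\<psi> - \<phi> = \<theta>] (rmod (2 * pi))"
    unfolding directed_angle_def by blast
  then obtain s where s: "\<And>\<phi>. polar_pt F \<omega> e l \<phi> = conic_pt F a b (\<phi> + s)"
    using polar_pt_on_conic[OF assms] by blast
  have "[\<phi> + s = \<alpha>] (rmod (2 * pi))"
    using V assms by (simp add: s conic_pt_eq_iff rcong_sym_iff)
  from rcong_add[OF this \<theta>] have "[\<psi> + s = \<alpha> + \<theta>] (rmod (2 * pi))"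
    by (simp add: algebra_simps)
  then show "W = conic_pt F a b (\<alpha> + \<theta>)"
    unfolding W s by (rule conic_pt_cong)
next
  assume W: "W = conic_pt F a b (\<alpha> + \<theta>)"
  have "conic_with_focus F (range (conic_pt F a b))"
    using assms by (auto simp: conic_with_focus_iff)
  then obtain \<omega> e l where eqn: "polar_eqn F (range (conic_pt F a b)) \<omega> e l"
    by (auto simp: conic_with_focus_def)
  then obtain s where s: "\<And>\<phi>. polar_pt F \<omega> e l \<phi> = conic_pt F a b (\<phi> + s)"
    using polar_pt_on_conic[OF assms] by blast
  show "directed_angle F (range (conic_pt F a b)) (conic_pt F a b \<alpha>) W \<theta>"
    unfolding directed_angle_def
    by (rule exI[of _ \<omega>], rule exI[of _ e], rule exI[of _ l], rule exI[of _ "\<alpha> - s"],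
        rule exI[of _ "\<alpha> - s + \<theta>"]) (use eqn W in \<open>simp add: s algebra_simps\<close>)
qed

section \<open>Tangents\<close>

definition tangent_line :: "real^2 \<Rightarrow> real \<Rightarrow> real^2 \<Rightarrow> real \<Rightarrow> rp2 set" where
  "tangent_line F a b \<alpha> = affine_line F (b + a *\<^sub>R unit_dir \<alpha>)"

lemma is_line_tangent_line: "is_line (tangent_line F a b \<alpha>)"
  by (simp add: tangent_line_def is_line_affine_line)

lemma tangent_line_eq_iff:
  "a \<noteq> 0 \<Longrightarrow> tangent_line F a b \<alpha> = tangent_line F a b \<beta> \<longleftrightarrow> [\<alpha> = \<beta>] (rmod (2 * pi))"
  by (simp add: tangent_line_def unit_dir_eq_iff)

text \<open>The terms in \<open>b\<close> cancel, and evenness of the cosine treats the angles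
  \<open>\<beta> - \<delta>\<close> and \<open>\<beta> + \<delta>\<close> at once. Both chords and
  intersections of tangents are found by this criterion.\<close>

lemma conic_pt_mem_tangent_line:
  "conic_pt F a b \<alpha> \<in> tangent_line F a' b \<beta> \<longleftrightarrow> a = a' * cos (\<alpha> - \<beta>)"
  by (simp add: tangent_line_def conic_pt_mem_affine_line inner_simps unit_dir_inner cos_diff algebra_simps)

lemma join_conic_pt:
  assumes "a \<noteq> 0" "cos \<delta> \<noteq> 0" "conic_pt F a b (\<beta> - \<delta>) \<noteq> conic_pt F a b (\<beta> + \<delta>)"
  shows "join (conic_pt F a b (\<beta> - \<delta>)) (conic_pt F a b (\<beta> + \<delta>)) = tangent_line F (a / cos \<delta>) b \<beta>"
  using assms by (intro join_eqI) (auto simp: is_line_tangent_line conic_pt_mem_tangent_line)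

text \<open>If \<open>cos \<delta> = 0\<close>, the points of contact are the ends of a focal chord,
  and the tangents meet on the directrix \<open>z = b \<bullet> x\<close>, which is at infinity for
  \<open>b = 0\<close>.\<close>

lemma meet_tangent_line:
  assumes "a \<noteq> 0" "\<not> [\<beta> - \<delta> = \<beta> + \<delta>] (rmod (2 * pi))"
  shows "meet (tangent_line F a b (\<beta> - \<delta>)) (tangent_line F a b (\<beta> + \<delta>)) =
    conic_pt F (a * cos \<delta>) b \<beta>"
  using assms
  by (intro meet_eqI) (auto simp: is_line_tangent_line conic_pt_mem_tangent_line tangent_line_eq_iff)

text \<open>Eliminates the parameter angle: the equation is homogeneous and can be differentiated
  along an arbitrary lift.\<close>

lemma conic_pt_quadratic:
  assumes "v \<noteq> 0" "proj v \<in> range (conic_pt F a b)"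
  defines "x \<equiv> fst v - snd v *\<^sub>R F"
  shows "(snd v - b \<bullet> x)\<^sup>2 = a\<^sup>2 * (x \<bullet> x)"
proof -
  obtain \<alpha> where "proj v = proj (homog F (unit_dir \<alpha>) (a + b \<bullet> unit_dir \<alpha>))"
    using assms(2) by (auto simp: conic_pt_def)
  then obtain c where "v = c *\<^sub>R homog F (unit_dir \<alpha>) (a + b \<bullet> unit_dir \<alpha>)"
    using assms(1) by (elim proj_eqD[rotated 2]) auto
  then have "v = homog F (c *\<^sub>R unit_dir \<alpha>) (c * (a + b \<bullet> unit_dir \<alpha>))"
    by (simp add: homog_scale)
  then have "x = c *\<^sub>R unit_dir \<alpha>" "snd v = c * (a + b \<bullet> unit_dir \<alpha>)"
    by (simp_all add: x_def homog_def)
  then show ?thesis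
    by (simp add: unit_dir_inner algebra_simps power2_eq_square)
qed

text \<open>Differentiating the quadratic equation along the lift puts \<open>\<gamma>'\<close> on
  \<open>tangent_line F a b \<alpha>\<close>; independence of \<open>\<gamma> t\<close> and
  \<open>\<gamma>'\<close> makes this line their join.\<close>

lemma tangent_at_conic_ptD:
  assumes "a \<noteq> 0" "tangent_at (range (conic_pt F a b)) V L"
  obtains \<alpha> where "V = conic_pt F a b \<alpha>" "L = tangent_line F a b \<alpha>"
proof -
  obtain \<gamma> \<gamma>' t where \<gamma>: "\<And>s. \<gamma> s \<noteq> 0" "\<And>s. proj (\<gamma> s) \<in> range (conic_pt F a b)"
    and deriv: "(\<gamma> has_vector_derivative \<gamma>') (at t)" and \<gamma>': "\<gamma>' \<notin> span {\<gamma> t}"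
    and V: "V = proj (\<gamma> t)" and L: "L = join (proj (\<gamma> t)) (proj \<gamma>')"
    using assms(2) unfolding tangent_at_def by blast
  obtain \<alpha> where \<alpha>: "V = conic_pt F a b \<alpha>" using \<gamma>(2) V by blast
  then obtain c where c: "c \<noteq> 0" "\<gamma> t = c *\<^sub>R homog F (unit_dir \<alpha>) (a + b \<bullet> unit_dir \<alpha>)"
    using \<gamma>(1)[of t] unfolding V conic_pt_def by (elim proj_eqD[rotated 2]) auto
  define g where "g v = fst v - snd v *\<^sub>R F" for v :: "(real^2) \<times> real"
  have gt: "g (\<gamma> t) = c *\<^sub>R unit_dir \<alpha>" "snd (\<gamma> t) = c * (a + b \<bullet> unit_dir \<alpha>)"
    using c by (simp_all add: g_def homog_def algebra_simps)
  define f where "f v = (snd v - b \<bullet> g v)\<^sup>2 - a\<^sup>2 * (g v \<bullet> g v)" for v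
  define D where "D = 2 * (snd (\<gamma> t) - b \<bullet> g (\<gamma> t)) * (snd \<gamma>' - b \<bullet> g \<gamma>') - a\<^sup>2 * (2 * (g (\<gamma> t) \<bullet> g \<gamma>'))"
  have "(\<gamma> has_derivative (\<lambda>h. h *\<^sub>R \<gamma>')) (at t)"
    using deriv by (simp add: has_vector_derivative_def)
  then have "((\<lambda>s. f (\<gamma> s)) has_derivative (\<lambda>h. h * D)) (at t)"
    unfolding f_def g_def
    by (auto intro!: derivative_eq_intros
        simp: D_def g_def fun_eq_iff inner_simps inner_commute algebra_simps)
  moreover have "f (\<gamma> s) = 0" for s
    using conic_pt_quadratic[OF \<gamma>(1) \<gamma>(2)] by (simp add: f_def g_def)
  ultimately have "((\<lambda>s. 0) has_derivative (\<lambda>h. h * D)) (at t)" by simp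
  then have "(\<lambda>h. h * D) = (\<lambda>h. 0)"
    using has_derivative_const has_derivative_unique by blast
  then have "D = 0" by (metis mult_1)
  \<comment> \<open>Since \<open>snd (\<gamma> t) - b \<bullet> g (\<gamma> t) = c * a\<close>,
    \<open>D\<close> is \<open>2 * a * c\<close> times the equation of the tangent line evaluated at
    \<open>\<gamma>'\<close>.\<close>
  then have "2 * a * c * (snd \<gamma>' - b \<bullet> g \<gamma>' - a * (unit_dir \<alpha> \<bullet> g \<gamma>')) = 0"
    by (simp add: D_def gt algebra_simps power2_eq_square)
  then have "snd \<gamma>' = (b + a *\<^sub>R unit_dir \<alpha>) \<bullet> g \<gamma>'"
    using assms(1) c(1) by (simp add: inner_simps)
  moreover have "\<gamma>' \<noteq> 0" using \<gamma>' by (auto simp: span_zero)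
  moreover have \<gamma>'_eq: "\<gamma>' = homog F (g \<gamma>') (snd \<gamma>')" by (simp add: g_def homog_def)
  ultimately have "proj \<gamma>' \<in> tangent_line F a b \<alpha>"
    unfolding tangent_line_def by (metis homog_eq_0_iff proj_homog_mem_affine_line)
  moreover have "V \<in> tangent_line F a b \<alpha>"
    by (simp add: \<alpha> conic_pt_mem_tangent_line)
  moreover have "V \<noteq> proj \<gamma>'"
    using \<gamma>' \<gamma>(1) \<open>\<gamma>' \<noteq> 0\<close> unfolding V by (metis Rep_rp2_proj insertI1 span_base)
  ultimately have "L = tangent_line F a b \<alpha>"
    unfolding L using V by (intro join_eqI) (auto simp: is_line_tangent_line)
  with \<alpha> show thesis using that by blast
qed

lemma unit_dir_has_vector_derivative:
  "(unit_dir has_vector_derivative unit_dir (\<alpha> + pi / 2)) (at \<alpha>)"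
proof -
  have "((\<lambda>t. cos t *\<^sub>R unit_dir 0 + sin t *\<^sub>R unit_dir (0 + pi / 2)) has_vector_derivative
      - sin \<alpha> *\<^sub>R unit_dir 0 + cos \<alpha> *\<^sub>R unit_dir (0 + pi / 2)) (at \<alpha>)"
    using DERIV_cos[of \<alpha>] DERIV_sin[of \<alpha>]
    by (intro has_vector_derivative_add bounded_linear.has_vector_derivative[OF bounded_linear_scaleR_left])
       (simp_all add: has_real_derivative_iff_has_vector_derivative)
  moreover have "unit_dir = (\<lambda>t. cos t *\<^sub>R unit_dir 0 + sin t *\<^sub>R unit_dir (0 + pi / 2))"
    by (simp add: fun_eq_iff vec_eq_iff forall_2)
  moreover have "unit_dir (\<alpha> + pi / 2) = - sin \<alpha> *\<^sub>R unit_dir 0 + cos \<alpha> *\<^sub>R unit_dir (0 + pi / 2)"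
    by (simp add: vec_eq_iff forall_2 cos_add sin_add)
  ultimately show ?thesis by metis
qed

text \<open>The angle parametrisation is itself a regular lift: the vector part of its derivative is
  perpendicular to \<open>unit_dir \<alpha>\<close>, which gives independence and removes
  \<open>a\<close> from the incidence with the line.\<close>

lemma tangent_at_conic_pt:
  "tangent_at (range (conic_pt F a b)) (conic_pt F a b \<alpha>) (tangent_line F a b \<alpha>)"
proof -
  let ?u = "unit_dir (\<alpha> + pi / 2)"
  define \<gamma> where "\<gamma> s = homog F (unit_dir s) (a + b \<bullet> unit_dir s)" for s
  define \<gamma>' where "\<gamma>' = homog F ?u (b \<bullet> ?u)"
  have "((\<lambda>s. a + b \<bullet> unit_dir s) has_vector_derivative 0 + b \<bullet> ?u) (at \<alpha>)"
    by (intro has_vector_derivative_add has_vector_derivative_const unit_dir_has_vector_derivative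
        bounded_linear.has_vector_derivative[OF bounded_linear_inner_right])
  then have deriv: "(\<gamma> has_vector_derivative \<gamma>') (at \<alpha>)"
    unfolding \<gamma>_def \<gamma>'_def homog_def add_0
    by (intro has_vector_derivative_Pair has_vector_derivative_add unit_dir_has_vector_derivative
        bounded_linear.has_vector_derivative[OF bounded_linear_scaleR_left])
  have perp: "unit_dir \<alpha> \<bullet> ?u = 0" by (simp add: unit_dir_inner)
  have nspan: "\<gamma>' \<notin> span {\<gamma> \<alpha>}"
  proof
    assume "\<gamma>' \<in> span {\<gamma> \<alpha>}"
    then obtain c where "\<gamma>' = c *\<^sub>R \<gamma> \<alpha>" by (auto simp: span_singleton)
    then have "?u = c *\<^sub>R unit_dir \<alpha>"
      unfolding \<gamma>_def \<gamma>'_def by (simp only: homog_scale homog_eq_iff)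
    then have "?u \<bullet> ?u = 0" using perp by (metis inner_scaleR_left mult_zero_right)
    then show False by simp
  qed
  have "\<gamma> \<alpha> \<noteq> 0" "\<gamma>' \<noteq> 0" by (simp_all add: \<gamma>_def \<gamma>'_def)
  then have "proj (\<gamma> \<alpha>) \<noteq> proj \<gamma>'"
    using nspan by (metis Rep_rp2_proj insertI1 span_base)
  moreover have "proj \<gamma>' \<in> tangent_line F a b \<alpha>"
    by (simp add: \<gamma>'_def tangent_line_def proj_homog_mem_affine_line inner_simps perp)
  moreover have "proj (\<gamma> \<alpha>) \<in> tangent_line F a b \<alpha>"
    using conic_pt_mem_tangent_line[of F a b \<alpha> a \<alpha>] by (simp add: conic_pt_def \<gamma>_def)
  ultimately have join: "tangent_line F a b \<alpha> = join (proj (\<gamma> \<alpha>)) (proj \<gamma>')"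
    by (intro join_eqI[symmetric]) (auto simp: is_line_tangent_line)
  have pt: "conic_pt F a b s = proj (\<gamma> s)" for s by (simp add: \<gamma>_def conic_pt_def)
  have "\<forall>s. \<gamma> s \<noteq> 0 \<and> proj (\<gamma> s) \<in> range (conic_pt F a b)"
    by (auto simp flip: pt) (simp add: \<gamma>_def)
  then show ?thesis
    unfolding tangent_at_def using deriv nspan join pt by blast
qed

text \<open>Points and tangent lines each determine the angle modulo \<open>2 * pi\<close>, hence
  one another. The same argument evaluates the point of tangency in \<open>H_op\<close>.\<close>

lemma tangent_conic_pt:
  assumes "a \<noteq> 0"
  shows "tangent (range (conic_pt F a b)) (conic_pt F a b \<alpha>) = tangent_line F a b \<alpha>"
  unfolding tangent_def
proof (rule the_equality)
  show "tangent_at (range (conic_pt F a b)) (conic_pt F a b \<alpha>) (tangent_line F a b \<alpha>)"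
    by (rule tangent_at_conic_pt)
next
  fix L assume "tangent_at (range (conic_pt F a b)) (conic_pt F a b \<alpha>) L"
  then show "L = tangent_line F a b \<alpha>"
    using assms by (elim tangent_at_conic_ptD[OF assms])
      (simp add: tangent_line_eq_iff conic_pt_eq_iff rcong_sym_iff)
qed

lemma point_of_tangency_conic_pt:
  assumes "a \<noteq> 0"
  shows "(THE T. tangent_at (range (conic_pt F a b)) T (tangent_line F a b \<alpha>)) = conic_pt F a b \<alpha>"
proof (rule the_equality)
  show "tangent_at (range (conic_pt F a b)) (conic_pt F a b \<alpha>) (tangent_line F a b \<alpha>)"
    by (rule tangent_at_conic_pt)
next
  fix T assume "tangent_at (range (conic_pt F a b)) T (tangent_line F a b \<alpha>)"
  then show "T = conic_pt F a b \<alpha>"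
    using assms by (elim tangent_at_conic_ptD[OF assms])
      (simp add: tangent_line_eq_iff conic_pt_eq_iff rcong_sym_iff)
qed


section \<open>Lines through the focus\<close>

lemma join_focus_proj_homog:
  "join (affine_pt F) (proj (homog F (unit_dir \<alpha>) z)) =
    zero_line (unit_dir (\<alpha> + pi / 2), - (unit_dir (\<alpha> + pi / 2) \<bullet> F))"
proof (rule join_eqI)
  \<comment> \<open>The form with normal \<open>unit_dir (\<alpha> + pi / 2)\<close> vanishing at
    \<open>F\<close> does not see \<open>z\<close>, so the point at infinity used in
    \<open>dir_line\<close> yields the same line.\<close>
  let ?a = "(unit_dir (\<alpha> + pi / 2), - (unit_dir (\<alpha> + pi / 2) \<bullet> F))"
  show "is_line (zero_line ?a)"
    unfolding is_line_iff by (rule exI[of _ ?a]) (auto simp: zero_prod_def)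
  show "affine_pt F \<in> zero_line ?a"
    unfolding affine_pt_eq_proj_homog by (simp add: proj_mem_zero_line) (simp add: homog_def)
  show "proj (homog F (unit_dir \<alpha>) z) \<in> zero_line ?a"
    by (simp add: proj_mem_zero_line) (simp add: homog_def inner_simps unit_dir_inner)
  show "affine_pt F \<noteq> proj (homog F (unit_dir \<alpha>) z)"
  proof
    assume "affine_pt F = proj (homog F (unit_dir \<alpha>) z)"
    then obtain c where "c \<noteq> 0" "homog F 0 1 = homog F (c *\<^sub>R unit_dir \<alpha>) (c * z)"
      unfolding affine_pt_eq_proj_homog homog_scale[symmetric]
      by (elim proj_eqD[rotated 2]) auto
    then show False by simp
  qed
qed

lemma join_focus_conic_pt: "join (affine_pt F) (conic_pt F a b \<alpha>) = dir_line F \<alpha>"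
proof -
  have "(unit_dir \<alpha>, 0) = homog F (unit_dir \<alpha>) 0" by (simp add: homog_def)
  then show ?thesis by (simp add: dir_line_def conic_pt_def join_focus_proj_homog)
qed

section \<open>Discrete conics\<close>

lemma rcong_0_mult_of_int:
  assumes "[x = 0] (rmod m)"
  shows "[of_int q * x = 0] (rmod m)"
proof -
  obtain j where "x = of_int j * m"
    using rcong_sym[OF assms] by (auto simp: rcong_altdef)
  then have "of_int q * x = 0 + of_int (q * j) * m" by simp
  then show ?thesis using rcong_sym rcong_altdef by blast
qed

lemma rcong_add_eq_iff: "[x = x + y] (rmod m) \<longleftrightarrow> [y = 0] (rmod m)"
  using rcong_add_left_cancel[of x 0 y m] by (simp add: rcong_sym_iff)

text \<open>The angles form an arithmetic progression. Closing up after \<open>n\<close> steps,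
  together with distinctness of the vertices, says that \<open>\<theta>\<close> has order exactly
  \<open>n\<close> modulo \<open>2 * pi\<close>.\<close>

lemma discrete_conicD:
  assumes "discrete_conic F C \<theta> n V"
  obtains a b \<alpha> where "a \<noteq> 0" "C = range (conic_pt F a b)" "n \<ge> 3"
    "\<And>i. V i = conic_pt F a b (\<alpha> + of_int i * \<theta>)"
    "\<And>k. [of_int k * \<theta> = 0] (rmod (2 * pi)) \<longleftrightarrow> [k = 0] (mod int n)"
proof -
  have n: "n \<ge> 3" and per: "\<And>i. V (i + int n) = V i" and inj: "inj_on V {0..<int n}"
    and VC: "\<And>i. V i \<in> C" and ang: "\<And>i. directed_angle F C (V i) (V (i + 1)) \<theta>"
    using assms by (auto simp: discrete_conic_def closed_polygon_def)
  obtain a b where a: "a \<noteq> 0" and C: "C = range (conic_pt F a b)"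
    using assms by (auto simp: discrete_conic_def conic_with_focus_iff)
  obtain \<alpha> where \<alpha>: "V 0 = conic_pt F a b \<alpha>" using VC C by blast
  have V: "V i = conic_pt F a b (\<alpha> + of_int i * \<theta>)" for i
  proof (induction i rule: int_induct[where k = 0])
    case base
    then show ?case by (simp add: \<alpha>)
  next
    case (step1 i)
    then show ?case
      using ang[of i] a by (simp add: C directed_angle_conic_pt_iff algebra_simps)
  next
    case (step2 i)
    \<comment> \<open>Going backwards, \<open>V (i - 1)\<close> is first known only as some point of
      \<open>C\<close>; injectivity of the parametrisation then cancels
      \<open>\<theta>\<close>.\<close>
    obtain \<beta> where \<beta>: "V (i - 1) = conic_pt F a b \<beta>" using VC C by blast
    then have "V i = conic_pt F a b (\<beta> + \<theta>)"
      using ang[of "i - 1"] a by (simp add: C directed_angle_conic_pt_iff)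
    then have "[\<beta> + \<theta> = (\<alpha> + of_int (i - 1) * \<theta>) + \<theta>] (rmod (2 * pi))"
      using step2 a by (subst rcong_sym_iff) (simp add: conic_pt_eq_iff algebra_simps)
    then show ?case
      unfolding \<beta> rcong_add_right_cancel by (rule conic_pt_cong)
  qed
  have n\<theta>: "[of_int (int n) * \<theta> = 0] (rmod (2 * pi))"
    using per[of 0] a by (simp add: V conic_pt_eq_iff rcong_sym_iff rcong_add_eq_iff)
  have "[of_int k * \<theta> = 0] (rmod (2 * pi)) \<longleftrightarrow> [k = 0] (mod int n)" for k
  proof
    assume "[k = 0] (mod int n)"
    then obtain q where "k = q * int n" by (auto simp: cong_0_iff dvd_def mult.commute)
    then show "[of_int k * \<theta> = 0] (rmod (2 * pi))"
      using rcong_0_mult_of_int[OF n\<theta>, of q] by (simp add: mult.assoc)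
  next
    assume k: "[of_int k * \<theta> = 0] (rmod (2 * pi))"
    \<comment> \<open>The remainder lies in the index range on which \<open>V\<close> is
      injective.\<close>
    let ?r = "k mod int n"
    have "of_int k * \<theta> - of_int (k div int n) * (of_int (int n) * \<theta>) = of_int ?r * \<theta>"
      by (simp add: minus_div_mult_eq_mod[symmetric] algebra_simps)
    then have "[of_int ?r * \<theta> = 0] (rmod (2 * pi))"
      using rcong_diff[OF k rcong_0_mult_of_int[OF n\<theta>, of "k div int n"]] by simp
    then have "V ?r = V 0"
      using a by (simp add: V conic_pt_eq_iff rcong_sym_iff rcong_add_eq_iff)
    then have "?r = 0"
      using n by (intro inj_onD[OF inj]) auto
    then show "[k = 0] (mod int n)" by (simp add: cong_def)
  qed
  with a C n V show thesis using that by blast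
qed

text \<open>The condition \<open>per\<close> speaks of \<open>\<theta>\<close> and \<open>n\<close>
  alone, so it carries over from one conic to another; this is how \<open>P'\<close> inherits its
  angle and its distinct vertices.\<close>

lemma discrete_conicI:
  assumes "a \<noteq> 0" "n \<ge> 3" and V: "\<And>i. V i = conic_pt F a b (\<alpha> + of_int i * \<theta>)"
    and per: "\<And>k. [of_int k * \<theta> = 0] (rmod (2 * pi)) \<longleftrightarrow> [k = 0] (mod int n)"
  shows "discrete_conic F (range (conic_pt F a b)) \<theta> n V"
proof -
  have eq: "V i = V j \<longleftrightarrow> [i = j] (mod int n)" for i j
  proof -
    have "\<alpha> + of_int i * \<theta> = (\<alpha> + of_int j * \<theta>) + of_int (i - j) * \<theta>"
      by (simp add: algebra_simps)
    then have "V j = V i \<longleftrightarrow> [of_int (i - j) * \<theta> = 0] (rmod (2 * pi))"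
      using assms(1) by (metis V conic_pt_eq_iff rcong_add_eq_iff)
    then show ?thesis unfolding per cong_diff_iff_cong_0 by auto
  qed
  have "V (i + int n) = V i" for i by (simp add: eq cong_def)
  moreover have "inj_on V {0..<int n}" by (auto simp: inj_on_def eq cong_def)
  moreover have "directed_angle F (range (conic_pt F a b)) (V i) (V (i + 1)) \<theta>" for i
    using assms(1) by (simp add: V directed_angle_conic_pt_iff algebra_simps)
  ultimately show ?thesis
    using assms(1,2) by (auto simp: discrete_conic_def closed_polygon_def conic_with_focus_iff V)
qed

text \<open>Otherwise \<open>2 * \<theta>\<close> is a multiple of \<open>2 * pi\<close>, so
  \<open>n\<close> divides 2.\<close>

lemma sin_angle_nonzero:
  assumes "n \<ge> 3" "\<And>k. [of_int k * \<theta> = 0] (rmod (2 * pi)) \<longleftrightarrow> [k = 0] (mod int n)"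
  shows "sin \<theta> \<noteq> 0"
proof
  assume "sin \<theta> = 0"
  then obtain j where "\<theta> = of_int j * pi" by (auto simp: sin_zero_iff_int2)
  then have "of_int 2 * \<theta> = 0 + of_int j * (2 * pi)" by simp
  then have "[of_int 2 * \<theta> = 0] (rmod (2 * pi))"
    using rcong_sym rcong_altdef by blast
  then have "int n dvd 2" using assms(2)[of 2] by (simp add: cong_0_iff)
  then show False using zdvd_imp_le[of "int n" 2] assms(1) by simp
qed

text \<open>Incidence says \<open>(m - b) \<bullet> u = a\<close> for the direction \<open>u\<close>
  of each vertex, and three consecutive vertices force \<open>a = 0\<close>. This keeps the
  degenerate case apart.\<close>

lemma discrete_conic_not_on_line:
  assumes "discrete_conic F C \<theta> n V" "\<And>i. V i \<in> affine_line F m"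
  shows False
proof -
  obtain a b \<alpha> where a: "a \<noteq> 0" and n: "n \<ge> 3"
    and V: "\<And>i. V i = conic_pt F a b (\<alpha> + of_int i * \<theta>)"
    and per: "\<And>k. [of_int k * \<theta> = 0] (rmod (2 * pi)) \<longleftrightarrow> [k = 0] (mod int n)"
    using assms(1) by (rule discrete_conicD) blast
  have "(m - b) \<bullet> unit_dir (\<alpha> + of_int i * \<theta>) = a" for i
    using assms(2)[of i] by (simp add: V conic_pt_mem_affine_line inner_simps algebra_simps)
  from this[of "- 1"] this[of 0] this[of 1] have "a = 0"
    using inner_unit_dir_constant(2)[OF sin_angle_nonzero[OF n per], of "m - b" \<alpha> a] by simp
  with a show False by blast
qed

section \<open>Uniqueness of the conic touching the sides\<close>

lemma circle_through_three_points:
  assumes "sin \<theta> \<noteq> 0" "a \<noteq> 0"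
    and "\<And>i. norm (d + a *\<^sub>R unit_dir (\<beta> + of_int i * \<theta>)) = r"
  shows "d = 0" "r = \<bar>a\<bar>"
proof -
  \<comment> \<open>In the expanded square only the inner product with \<open>d\<close> depends on
    \<open>i\<close>, so it is constant; the indices -1, 0, 1 then give
    \<open>d = 0\<close>.\<close>
  have *: "d \<bullet> unit_dir (\<beta> + of_int i * \<theta>) = (r\<^sup>2 - a\<^sup>2 - d \<bullet> d) / (2 * a)" for i :: int
  proof -
    have "r\<^sup>2 = (d + a *\<^sub>R unit_dir (\<beta> + of_int i * \<theta>)) \<bullet> (d + a *\<^sub>R unit_dir (\<beta> + of_int i * \<theta>))"
      unfolding assms(3)[of i, symmetric] by (rule power2_norm_eq_inner)
    also have "\<dots> = d \<bullet> d + 2 * a * (d \<bullet> unit_dir (\<beta> + of_int i * \<theta>)) + a\<^sup>2"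
      by (simp add: inner_add_left inner_add_right inner_commute[of "unit_dir _" d] unit_dir_inner
          distrib_left power2_eq_square)
    finally show ?thesis using assms(2) by (simp add: field_simps)
  qed
  show "d = 0"
    using inner_unit_dir_constant(1)[OF assms(1), of d \<beta>] *[of "- 1"] *[of 0] *[of 1] by simp
  then show "r = \<bar>a\<bar>" using assms(3)[of 0] by simp
qed

lemma H_conic_eq:
  assumes "sin \<theta> \<noteq> 0" "a \<noteq> 0"
    and side: "\<And>i. side V i = tangent_line F a b (\<beta> + of_int i * \<theta>)"
  shows "H_conic F V = range (conic_pt F a b)"
  unfolding H_conic_def
proof (rule the_equality)
  show "conic_with_focus F (range (conic_pt F a b)) \<and>
      (\<forall>i. \<exists>T. tangent_at (range (conic_pt F a b)) T (side V i))"
    unfolding side using assms(2) tangent_at_conic_pt conic_with_focus_iff by blast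
next
  fix C assume C: "conic_with_focus F C \<and> (\<forall>i. \<exists>T. tangent_at C T (side V i))"
  then obtain a' b' where a': "a' \<noteq> 0" and C_eq: "C = range (conic_pt F a' b')"
    by (auto simp: conic_with_focus_iff)
  \<comment> \<open>The sides are tangents of both conics, so their dual vectors lie at distance
    \<open>\<bar>a\<bar>\<close> from \<open>b\<close> and \<open>\<bar>a'\<bar>\<close> from
    \<open>b'\<close>: two circles share three points.\<close>
  have "norm ((b - b') + a *\<^sub>R unit_dir (\<beta> + of_int i * \<theta>)) = \<bar>a'\<bar>" for i
  proof -
    obtain \<gamma> where "side V i = tangent_line F a' b' \<gamma>"
      using C tangent_at_conic_ptD[OF a'] unfolding C_eq by metis
    then have "(b - b') + a *\<^sub>R unit_dir (\<beta> + of_int i * \<theta>) = a' *\<^sub>R unit_dir \<gamma>"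
      unfolding side tangent_line_def affine_line_inject by (simp add: algebra_simps)
    then show ?thesis by simp
  qed
  note circle_through_three_points[OF assms(1,2) this]
  then have "b' = b" "a' = a \<or> a' = - a" by auto
  then show "C = range (conic_pt F a b)"
    unfolding C_eq by (metis range_conic_pt_uminus)
qed

lemma cos_half_eq_0_iff: "cos (x / 2) = 0 \<longleftrightarrow> [x = pi] (rmod (2 * pi))"
proof -
  have "cos (x / 2) = 0 \<longleftrightarrow> (\<exists>j. odd j \<and> x = of_int j * pi)"
    by (simp add: cos_zero_iff_int field_simps)
  also have "\<dots> \<longleftrightarrow> (\<exists>j. x = of_int (2 * j + 1) * pi)"
    by (metis even_plus_one_iff dvd_triv_left oddE)
  also have "\<dots> \<longleftrightarrow> [pi = x] (rmod (2 * pi))"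
    by (simp add: rcong_altdef algebra_simps)
  finally show ?thesis by (simp add: rcong_sym_iff)
qed

theorem theorem6:
  fixes F :: "real^2" and c :: "rp2 set" and \<theta> :: real and n :: nat and k :: int
    and P P' :: "int \<Rightarrow> rp2"
  assumes "discrete_conic F c \<theta> n P"
    and "\<not> [k = 0] (mod int n)"
    and "\<forall>i. P' i = meet (side P i) (side P (i + k))"
  shows "P' = G_op k (H_op F P) \<and>
    ((\<exists>c'. discrete_conic F c' \<theta> n P') \<longleftrightarrow> \<not> [k * \<theta> = pi] (rmod (2 * pi))) \<and>
    ((\<exists>m. degenerate_discrete_conic F m \<theta> n P') \<longleftrightarrow> [k * \<theta> = pi] (rmod (2 * pi)))"
proof -
  obtain a b \<alpha> where a: "a \<noteq> 0" and n: "n \<ge> 3"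
    and P: "\<And>i. P i = conic_pt F a b (\<alpha> + of_int i * \<theta>)"
    and per: "\<And>k. [of_int k * \<theta> = 0] (rmod (2 * pi)) \<longleftrightarrow> [k = 0] (mod int n)"
    using assms(1) by (rule discrete_conicD) blast
  have sin: "sin \<theta> \<noteq> 0" by (rule sin_angle_nonzero[OF n per])
  \<comment> \<open>Each side is a chord with half angle \<open>\<theta> / 2\<close>, hence tangent
    to the conic given by \<open>a'\<close> and \<open>b\<close>; it touches at the mean angle of
    its ends, whence the half step in \<open>\<beta>\<close> below.\<close>
  define a' where "a' = a / cos (\<theta> / 2)"
  have cos: "cos (\<theta> / 2) \<noteq> 0"
    using sin sin_double[of "\<theta> / 2"] by auto
  then have a': "a' \<noteq> 0" using a by (simp add: a'_def)
  define \<beta> where "\<beta> = \<alpha> + \<theta> / 2"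
  have side: "side P i = tangent_line F a' b (\<beta> + of_int i * \<theta>)" for i
  proof -
    let ?m = "\<beta> + of_int i * \<theta>"
    have eq: "P i = conic_pt F a b (?m - \<theta> / 2)" "P (i + 1) = conic_pt F a b (?m + \<theta> / 2)"
      by (simp_all add: P \<beta>_def algebra_simps)
    have "\<not> [1 = 0] (mod int n)" using n by (simp add: cong_def)
    then have "\<not> [?m - \<theta> / 2 = ?m - \<theta> / 2 + \<theta>] (rmod (2 * pi))"
      using per[of 1] by (simp only: rcong_add_eq_iff of_int_1 mult_1 simp_thms)
    then have "conic_pt F a b (?m - \<theta> / 2) \<noteq> conic_pt F a b (?m + \<theta> / 2)"
      using a by (simp add: conic_pt_eq_iff add.commute)
    then show ?thesis
      unfolding side_def eq a'_def by (rule join_conic_pt[OF a cos])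
  qed
  have H_conic: "H_conic F P = range (conic_pt F a' b)"
    by (rule H_conic_eq[OF sin a' side])
  have H: "H_op F P = (range (conic_pt F a' b), \<lambda>i. conic_pt F a' b (\<beta> + of_int i * \<theta>))"
    unfolding H_op_def H_conic side by (simp add: point_of_tangency_conic_pt[OF a'])
  have G: "P' = G_op k (H_op F P)"
    unfolding H G_op_def using assms(3) by (simp add: fun_eq_iff tangent_conic_pt[OF a'] side)
  \<comment> \<open>The tangents with indices \<open>i\<close> and \<open>i + k\<close> have half
    angle \<open>k * \<theta> / 2\<close>, so they meet at their mean angle on the curve given by
    \<open>a''\<close> and the same \<open>b\<close>.\<close>
  define a'' where "a'' = a' * cos (of_int k * \<theta> / 2)"
  define \<gamma> where "\<gamma> = \<beta> + of_int k * \<theta> / 2"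
  have P': "P' i = conic_pt F a'' b (\<gamma> + of_int i * \<theta>)" for i
  proof -
    let ?m = "\<gamma> + of_int i * \<theta>" and ?d = "of_int k * \<theta> / 2"
    have "\<beta> + of_int i * \<theta> = ?m - ?d" "\<beta> + of_int (i + k) * \<theta> = ?m + ?d"
      by (simp_all add: \<gamma>_def algebra_simps)
    then have "P' i = meet (tangent_line F a' b (?m - ?d)) (tangent_line F a' b (?m + ?d))"
      using assms(3) by (simp only: side)
    moreover have "?m - ?d + of_int k * \<theta> = ?m + ?d" by simp
    then have "\<not> [?m - ?d = ?m + ?d] (rmod (2 * pi))"
      using assms(2) per[of k] rcong_add_eq_iff[of "?m - ?d" "of_int k * \<theta>"] by metis
    ultimately show ?thesis
      unfolding a''_def using meet_tangent_line[OF a'] by simp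
  qed
  have a''_iff: "a'' = 0 \<longleftrightarrow> [k * \<theta> = pi] (rmod (2 * pi))"
    using a' by (simp add: a''_def cos_half_eq_0_iff)
  have conic: "discrete_conic F (range (conic_pt F a'' b)) \<theta> n P'" if "a'' \<noteq> 0"
    by (rule discrete_conicI[OF that n P' per])
  \<comment> \<open>The carrying line is the directrix for \<open>F\<close> shared by
    \<open>c\<close> and the conic touching the sides.\<close>
  have degenerate: "degenerate_discrete_conic F (affine_line F b) \<theta> n P'" if "a'' = 0"
  proof -
    have "[of_int (int n) * \<theta> = 0] (rmod (2 * pi))"
      using per[of "int n"] by (simp add: cong_def)
    then have "[\<gamma> + of_int i * \<theta> = \<gamma> + of_int i * \<theta> + of_int (int n) * \<theta>] (rmod (2 * pi))" for i
      by (simp only: rcong_add_eq_iff)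
    then have "P' (i + int n) = P' i" for i
      unfolding P' by (intro conic_pt_cong, subst rcong_sym_iff) (simp add: algebra_simps)
    moreover have "P' i \<in> affine_line F b" for i
      using that by (simp add: P' conic_pt_mem_affine_line)
    moreover have "\<exists>\<alpha> \<beta>. join (affine_pt F) (P' i) = dir_line F \<alpha> \<and>
        join (affine_pt F) (P' (i + 1)) = dir_line F \<beta> \<and> [\<beta> - \<alpha> = \<theta>] (rmod pi)" for i
      unfolding P' join_focus_conic_pt
      by (rule exI[of _ "\<gamma> + of_int i * \<theta>"], rule exI[of _ "\<gamma> + of_int (i + 1) * \<theta>"])
         (simp add: algebra_simps)
    ultimately show ?thesis
      using n by (auto simp: degenerate_discrete_conic_def closed_polygon_def
          is_line_affine_line focus_notin_affine_line)
  qed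
  \<comment> \<open>Both equivalences quantify over all conics and all lines, not only over those
    constructed, so the two cases have to exclude each other.\<close>
  have excl: False
    if "discrete_conic F c' \<theta> n P'" "degenerate_discrete_conic F m \<theta> n P'" for c' m
    using that(2) discrete_conic_not_on_line[OF that(1)] line_not_through_focus[of m F]
    unfolding degenerate_discrete_conic_def by metis
  show ?thesis
    using G conic degenerate excl a''_iff by blast
qed

end
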